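(* For a soft topological space $(Z,\mathfrak{I},E)$, the following are equivalent: (1) $\mathfrak{I}$ is maximal soft compact; (2) the family of all soft $\mathfrak{I}$-closed sets is equal to the family of all soft $\mathfrak{I}$-compact sets; (3) each soft continuous bijection from a soft compact space onto $(Z,\mathfrak{I},E)$ is a soft homeomorphism.
   Context: A soft set over $Z$ with parameter set $E$ is a pair $(A,E)$ where $A:E\to\mathcal{P}(Z)$ is a map. Inclusion, unions, intersections and complements of soft sets are taken parameterwise. The null soft set $\widetilde{\Phi}$ is $\emptyset$ at every $e$; the absolute soft set $\widetilde{Z}$ is $Z$ at every $e$. A soft topology on $Z$ is a collection $\mathfrak{I}$ of soft sets over $Z$ containing $\widetilde{\Phi},\widetilde{Z}$, closed under intersections of two members and under arbitrary unions; $(Z,\mathfrak{I},E)$ is then a soft topological space. Members of $\mathfrak{I}$ are soft ($\mathfrak{I}$-)open, their complements soft ($\mathfrak{I}$-)closed. A soft set $(A,E)$ is soft ($\mathfrak{I}$-)compact if every family of soft open sets whose union contains $(A,E)$ has a finite subfamily whose union contains $(A,E)$; the space is soft compact if $\widetilde{Z}$ is soft compact. $\mathfrak{I}$ is maximal soft compact if $(Z,\mathfrak{I},E)$ is soft compact and no soft topology on $Z$ (with parameter set $E$) strictly containing $\mathfrak{I}$ is soft compact. A soft function $f:(Y,\mathfrak{I}',E')\to(Z,\mathfrak{I},E)$ between soft topological spaces is given by a pair of functions $p:Y\to Z$, $q:E'\to E$. The image of a soft set $(A,E')$ over $Y$ is the soft set over $Z$ with $f(A)(e)=\bigcup_{e'\in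 q^{-1}(e)}p(A(e'))$ for $e\in E$ (empty if $q^{-1}(e)=\emptyset$), and the inverse image of a soft set $(B,E)$ over $Z$ is the soft set over $Y$ with $f^{-1}(B)(e')=p^{-1}(B(q(e')))$ for $e'\in E'$. $f$ is bijective if both $p$ and $q$ are bijective; soft continuous if inverse images of soft open sets are soft open; soft open if images of soft open sets are soft open; a soft homeomorphism if it is a soft open, soft continuous bijection.
   Formalization: The implication from (3) to (1) and (2) is stated only for soft compact (Z,I,E): if the space is not soft compact, e.g. the natural numbers with the discrete soft topology, (3) holds vacuously while (1) and (2) fail. *)

theory Defs
  imports "HOL-Library.FuncSet"
begin

text \<open>
  A soft set over \<open>Z\<close> with parameter set \<open>E\<close> is a map from \<open>E\<close> to the power set of \<open>Z\<close>. It is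
  encoded as a total function taking the value \<open>{}\<close> outside \<open>E\<close>, so that two soft sets are equal
  exactly when they agree on \<open>E\<close>, and parameterwise inclusion, intersection and union are
  \<open>\<le>\<close>, \<open>inf\<close> and \<open>Sup\<close> of the pointwise function order. The carriers \<open>Z\<close> and \<open>E\<close> may be empty sets.
\<close>

definition soft_sets :: "'z set \<Rightarrow> 'e set \<Rightarrow> ('e \<Rightarrow> 'z set) set" where
  "soft_sets Z E = {A. (\<forall>e\<in>E. A e \<subseteq> Z) \<and> (\<forall>e. e \<notin> E \<longrightarrow> A e = {})}"

definition soft_null :: "'e \<Rightarrow> 'z set" where
  "soft_null = (\<lambda>e. {})"

definition soft_absolute :: "'z set \<Rightarrow> 'e set \<Rightarrow> 'e \<Rightarrow> 'z set" where
  "soft_absolute Z E = (\<lambda>e. if e \<in> E then Z else {})"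

definition soft_complement :: "'z set \<Rightarrow> 'e set \<Rightarrow> ('e \<Rightarrow> 'z set) \<Rightarrow> 'e \<Rightarrow> 'z set" where
  "soft_complement Z E A = (\<lambda>e. if e \<in> E then Z - A e else {})"

definition soft_topology :: "'z set \<Rightarrow> 'e set \<Rightarrow> ('e \<Rightarrow> 'z set) set \<Rightarrow> bool" where
  "soft_topology Z E T \<longleftrightarrow>
     T \<subseteq> soft_sets Z E \<and>
     soft_null \<in> T \<and> soft_absolute Z E \<in> T \<and>
     (\<forall>A\<in>T. \<forall>B\<in>T. inf A B \<in> T) \<and>
     (\<forall>\<U>. \<U> \<subseteq> T \<longrightarrow> Sup \<U> \<in> T)"

definition soft_closed_sets :: "'z set \<Rightarrow> 'e set \<Rightarrow> ('e \<Rightarrow> 'z set) set \<Rightarrow> ('e \<Rightarrow> 'z set) set" where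
  "soft_closed_sets Z E T = soft_complement Z E ` T"

definition soft_compact_sets :: "'z set \<Rightarrow> 'e set \<Rightarrow> ('e \<Rightarrow> 'z set) set \<Rightarrow> ('e \<Rightarrow> 'z set) set" where
  "soft_compact_sets Z E T =
     {A \<in> soft_sets Z E.
        \<forall>\<U>. \<U> \<subseteq> T \<and> A \<le> Sup \<U> \<longrightarrow> (\<exists>\<V>. \<V> \<subseteq> \<U> \<and> finite \<V> \<and> A \<le> Sup \<V>)}"

definition soft_compact_space :: "'z set \<Rightarrow> 'e set \<Rightarrow> ('e \<Rightarrow> 'z set) set \<Rightarrow> bool" where
  "soft_compact_space Z E T \<longleftrightarrow>
     soft_topology Z E T \<and> soft_absolute Z E \<in> soft_compact_sets Z E T"

definition maximal_soft_compact :: "'z set \<Rightarrow> 'e set \<Rightarrow> ('e \<Rightarrow> 'z set) set \<Rightarrow> bool" where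
  "maximal_soft_compact Z E T \<longleftrightarrow>
     soft_compact_space Z E T \<and>
     (\<forall>T'. soft_topology Z E T' \<and> T \<subset> T' \<longrightarrow> \<not> soft_compact_space Z E T')"

text \<open>
  A soft function from a space over \<open>Y\<close> with parameters \<open>E'\<close> to a space over \<open>Z\<close> with parameters
  \<open>E\<close> is a pair \<open>p\<close>, \<open>q\<close>, of which only the restrictions to \<open>Y\<close> and \<open>E'\<close> matter.
\<close>

definition soft_function ::
  "'y set \<Rightarrow> 'f set \<Rightarrow> 'z set \<Rightarrow> 'e set \<Rightarrow> ('y \<Rightarrow> 'z) \<Rightarrow> ('f \<Rightarrow> 'e) \<Rightarrow> bool" where
  "soft_function Y E' Z E p q \<longleftrightarrow> p \<in> Y \<rightarrow> Z \<and> q \<in> E' \<rightarrow> E"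

definition soft_image ::
  "'f set \<Rightarrow> ('y \<Rightarrow> 'z) \<Rightarrow> ('f \<Rightarrow> 'e) \<Rightarrow> ('f \<Rightarrow> 'y set) \<Rightarrow> 'e \<Rightarrow> 'z set" where
  "soft_image E' p q A = (\<lambda>e. \<Union>e'\<in>{e' \<in> E'. q e' = e}. p ` A e')"

definition soft_vimage ::
  "'y set \<Rightarrow> 'f set \<Rightarrow> ('y \<Rightarrow> 'z) \<Rightarrow> ('f \<Rightarrow> 'e) \<Rightarrow> ('e \<Rightarrow> 'z set) \<Rightarrow> 'f \<Rightarrow> 'y set" where
  "soft_vimage Y E' p q B = (\<lambda>e'. if e' \<in> E' then {y \<in> Y. p y \<in> B (q e')} else {})"

definition soft_bijective ::
  "'y set \<Rightarrow> 'f set \<Rightarrow> 'z set \<Rightarrow> 'e set \<Rightarrow> ('y \<Rightarrow> 'z) \<Rightarrow> ('f \<Rightarrow> 'e) \<Rightarrow> bool" where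
  "soft_bijective Y E' Z E p q \<longleftrightarrow> bij_betw p Y Z \<and> bij_betw q E' E"

definition soft_continuous ::
  "'y set \<Rightarrow> 'f set \<Rightarrow> ('f \<Rightarrow> 'y set) set \<Rightarrow> 'z set \<Rightarrow> 'e set \<Rightarrow> ('e \<Rightarrow> 'z set) set
   \<Rightarrow> ('y \<Rightarrow> 'z) \<Rightarrow> ('f \<Rightarrow> 'e) \<Rightarrow> bool" where
  "soft_continuous Y E' T' Z E T p q \<longleftrightarrow>
     soft_function Y E' Z E p q \<and> (\<forall>B\<in>T. soft_vimage Y E' p q B \<in> T')"

definition soft_open_function ::
  "'y set \<Rightarrow> 'f set \<Rightarrow> ('f \<Rightarrow> 'y set) set \<Rightarrow> 'z set \<Rightarrow> 'e set \<Rightarrow> ('e \<Rightarrow> 'z set) set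
   \<Rightarrow> ('y \<Rightarrow> 'z) \<Rightarrow> ('f \<Rightarrow> 'e) \<Rightarrow> bool" where
  "soft_open_function Y E' T' Z E T p q \<longleftrightarrow>
     soft_function Y E' Z E p q \<and> (\<forall>A\<in>T'. soft_image E' p q A \<in> T)"

definition soft_homeomorphism ::
  "'y set \<Rightarrow> 'f set \<Rightarrow> ('f \<Rightarrow> 'y set) set \<Rightarrow> 'z set \<Rightarrow> 'e set \<Rightarrow> ('e \<Rightarrow> 'z set) set
   \<Rightarrow> ('y \<Rightarrow> 'z) \<Rightarrow> ('f \<Rightarrow> 'e) \<Rightarrow> bool" where
  "soft_homeomorphism Y E' T' Z E T p q \<longleftrightarrow>
     soft_open_function Y E' T' Z E T p q \<and> soft_continuous Y E' T' Z E T p q \<and>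
     soft_bijective Y E' Z E p q"

end

theory Submission
  imports Defs
begin

text \<open>
  Two classical facts do most of the work: a closed set in a compact space is compact, and the
  continuous image of a compact set is compact. With them, closed and compact sets coinciding
  is as rigid as in a compact Hausdorff space: if \<open>W\<close> is open in a compact space that
  maps continuously and bijectively onto \<open>(Z, T, E)\<close>, then the complement of \<open>W\<close> is compact, so its
  image, which by bijectivity is the complement of the image of \<open>W\<close>, is compact and therefore
  closed; hence the image of \<open>W\<close> is open. Applied to an identity map,
  this reasoning shows that \<open>T\<close> has no strictly finer compact topology; applied in general, it shows
  that every such bijection is a homeomorphism. Conversely, if every such bijection is a
  homeomorphism, then identity maps out of finer compact topologies are open, and \<open>T\<close> is maximal.

  The remaining step is that maximality makes every compact set \<open>A\<close> closed. Enlarge \<open>T\<close> just enough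
  to make the complement \<open>B\<close> of \<open>A\<close> open, by taking all \<open>U \<union> (V \<inter> B)\<close> with \<open>U\<close> and \<open>V\<close>
  in \<open>T\<close>. This enlargement is still compact (lemma
  \<open>soft_compact_space_simple_extension\<close>), so maximality forces \<open>B\<close> to belong to \<open>T\<close> already.
\<close>

lemma soft_sets_subset: "A \<in> soft_sets Z E \<Longrightarrow> A e \<subseteq> Z"
  by (cases "e \<in> E") (auto simp: soft_sets_def)

lemma soft_sets_outside: "A \<in> soft_sets Z E \<Longrightarrow> e \<notin> E \<Longrightarrow> A e = {}"
  by (auto simp: soft_sets_def)

lemma soft_sets_le_absolute: "A \<in> soft_sets Z E \<Longrightarrow> A \<le> soft_absolute Z E"
  by (auto simp: le_fun_def soft_absolute_def soft_sets_def)

lemma soft_complement_in_soft_sets: "soft_complement Z E A \<in> soft_sets Z E"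
  by (auto simp: soft_sets_def soft_complement_def)

lemma soft_complement_complement:
  "A \<in> soft_sets Z E \<Longrightarrow> soft_complement Z E (soft_complement Z E A) = A"
  by (auto simp: soft_sets_def soft_complement_def fun_eq_iff)

lemma soft_complement_null: "soft_complement Z E soft_null = soft_absolute Z E"
  by (simp add: soft_complement_def soft_absolute_def soft_null_def fun_eq_iff)

lemma soft_topology_subset: "soft_topology Z E T \<Longrightarrow> T \<subseteq> soft_sets Z E"
  and soft_topology_null: "soft_topology Z E T \<Longrightarrow> soft_null \<in> T"
  and soft_topology_absolute: "soft_topology Z E T \<Longrightarrow> soft_absolute Z E \<in> T"
  and soft_topology_inf: "soft_topology Z E T \<Longrightarrow> A \<in> T \<Longrightarrow> B \<in> T \<Longrightarrow> inf A B \<in> T"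
  and soft_topology_Sup: "soft_topology Z E T \<Longrightarrow> \<U> \<subseteq> T \<Longrightarrow> Sup \<U> \<in> T"
  by (auto simp: soft_topology_def)

lemma soft_topology_sup:
  assumes "soft_topology Z E T" "A \<in> T" "B \<in> T"
  shows "sup A B \<in> T"
  using soft_topology_Sup[OF assms(1), of "{A, B}"] assms(2,3) by simp

lemma soft_closed_sets_iff:
  assumes "soft_topology Z E T"
  shows "A \<in> soft_closed_sets Z E T \<longleftrightarrow> A \<in> soft_sets Z E \<and> soft_complement Z E A \<in> T"
  using soft_topology_subset[OF assms]
  by (force simp: soft_closed_sets_def soft_complement_in_soft_sets soft_complement_complement)

lemma soft_compact_sets_in_soft_sets: "A \<in> soft_compact_sets Z E T \<Longrightarrow> A \<in> soft_sets Z E"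
  by (simp add: soft_compact_sets_def)

text \<open>Indexed covers let a finite subcover be carried back along an auxiliary map
  (a choice of representatives, an inverse image) without choosing preimages of its members.\<close>

lemma soft_compact_sets_finite_subcover:
  assumes "A \<in> soft_compact_sets Z E T" "\<And>i. i \<in> I \<Longrightarrow> G i \<in> T" "A \<le> (SUP i\<in>I. G i)"
  obtains J where "J \<subseteq> I" "finite J" "A \<le> (SUP i\<in>J. G i)"
proof -
  have "G ` I \<subseteq> T" using assms(2) by auto
  then obtain \<V> where \<V>: "\<V> \<subseteq> G ` I" "finite \<V>" "A \<le> Sup \<V>"
    using assms(1,3) unfolding soft_compact_sets_def by blast
  obtain J where "J \<subseteq> I" "finite J" "\<V> = G ` J"
    using finite_subset_image[OF \<V>(2,1)] by blast
  with \<V>(3) that show thesis by blast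
qed

lemma soft_compact_sets_antimono:
  "T \<subseteq> T' \<Longrightarrow> soft_compact_sets Z E T' \<subseteq> soft_compact_sets Z E T"
  by (auto simp: soft_compact_sets_def)

text \<open>Adding the complement of the closed set to a cover of it gives a cover of the whole space.\<close>

lemma soft_closed_subset_compact:
  assumes "soft_compact_space Z E T"
  shows "soft_closed_sets Z E T \<subseteq> soft_compact_sets Z E T"
proof
  fix A assume A: "A \<in> soft_closed_sets Z E T"
  have top: "soft_topology Z E T" and comp: "soft_absolute Z E \<in> soft_compact_sets Z E T"
    using assms by (auto simp: soft_compact_space_def)
  have AS: "A \<in> soft_sets Z E" and CA: "soft_complement Z E A \<in> T"
    using A soft_closed_sets_iff[OF top] by auto
  have "\<exists>\<V>. \<V> \<subseteq> \<U> \<and> finite \<V> \<and> A \<le> Sup \<V>" if U: "\<U> \<subseteq> T" "A \<le> Sup \<U>" for \<U>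
  proof -
    let ?C = "soft_complement Z E A"
    have "soft_absolute Z E \<le> Sup (insert ?C \<U>)"
      using U(2) by (fastforce simp: le_fun_def soft_absolute_def soft_complement_def)
    then obtain \<V> where \<V>: "\<V> \<subseteq> insert ?C \<U>" "finite \<V>" "soft_absolute Z E \<le> Sup \<V>"
      using soft_compact_sets_finite_subcover[OF comp, of "insert ?C \<U>" "\<lambda>W. W"] U(1) CA
      by (auto simp: subset_iff)
    have "A \<le> Sup (\<V> - {?C})"
    proof (intro le_funI subsetI)
      fix e z assume z: "z \<in> A e"
      then have "z \<in> soft_absolute Z E e"
        using soft_sets_le_absolute[OF AS] by (auto simp: le_fun_def)
      then have "z \<in> Sup \<V> e"
        using \<V>(3) by (auto simp: le_fun_def)
      then obtain W where "W \<in> \<V>" "z \<in> W e" by auto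
      moreover have "z \<notin> ?C e"
        using z by (simp add: soft_complement_def)
      ultimately show "z \<in> Sup (\<V> - {?C}) e" by auto
    qed
    then show ?thesis using \<V>(1,2) by (intro exI[of _ "\<V> - {?C}"]) auto
  qed
  then show "A \<in> soft_compact_sets Z E T"
    using AS by (auto simp: soft_compact_sets_def)
qed

section \<open>Making one more soft set open\<close>

text \<open>For a soft topology \<open>T\<close> and a soft set \<open>B\<close>, the coarsest soft topology that contains both; for ordinary topologies it is
  known as Levine's simple extension.\<close>

definition simple_extension :: "('e \<Rightarrow> 'z set) set \<Rightarrow> ('e \<Rightarrow> 'z set) \<Rightarrow> ('e \<Rightarrow> 'z set) set" where
  "simple_extension T B = {sup U (inf V B) |U V. U \<in> T \<and> V \<in> T}"

lemma subset_simple_extension: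
  assumes "soft_topology Z E T"
  shows "T \<subseteq> simple_extension T B"
proof
  fix U assume "U \<in> T"
  moreover have "sup U (inf U B) = U" by simp
  ultimately show "U \<in> simple_extension T B"
    unfolding simple_extension_def by (metis (mono_tags, lifting) mem_Collect_eq)
qed

lemma in_simple_extension:
  assumes "soft_topology Z E T" "B \<in> soft_sets Z E"
  shows "B \<in> simple_extension T B"
proof -
  have "sup soft_null (inf (soft_absolute Z E) B) = B"
    using soft_sets_le_absolute[OF assms(2)] by (auto simp: soft_null_def fun_eq_iff le_fun_def)
  then show ?thesis
    using soft_topology_null[OF assms(1)] soft_topology_absolute[OF assms(1)]
    unfolding simple_extension_def by (metis (mono_tags, lifting) mem_Collect_eq)
qed

lemma simple_extension_choice:
  assumes "\<W> \<subseteq> simple_extension T B"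
  obtains u v where "\<And>W. W \<in> \<W> \<Longrightarrow> u W \<in> T" "\<And>W. W \<in> \<W> \<Longrightarrow> v W \<in> T"
    "\<And>W. W \<in> \<W> \<Longrightarrow> W = sup (u W) (inf (v W) B)"
proof -
  have "\<forall>W\<in>\<W>. \<exists>U V. U \<in> T \<and> V \<in> T \<and> W = sup U (inf V B)"
    using assms unfolding simple_extension_def by blast
  then show thesis using that by metis
qed

lemma soft_topology_simple_extension:
  assumes top: "soft_topology Z E T" and B: "B \<in> soft_sets Z E"
  shows "soft_topology Z E (simple_extension T B)"
  unfolding soft_topology_def
proof (intro conjI ballI allI impI)
  show "simple_extension T B \<subseteq> soft_sets Z E"
    using soft_topology_subset[OF top] B
    by (fastforce simp: simple_extension_def soft_sets_def)
  show "soft_null \<in> simple_extension T B" "soft_absolute Z E \<in> simple_extension T B"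
    using subset_simple_extension[OF top] soft_topology_null[OF top] soft_topology_absolute[OF top]
    by blast+
next
  fix X Y assume "X \<in> simple_extension T B" "Y \<in> simple_extension T B"
  then obtain U V U' V' where T: "U \<in> T" "V \<in> T" "U' \<in> T" "V' \<in> T"
    and X: "X = sup U (inf V B)" and Y: "Y = sup U' (inf V' B)"
    by (auto simp: simple_extension_def)
  \<comment> \<open>Inside \<open>B\<close> the two sets look like \<open>U \<union> V\<close> and \<open>U' \<union> V'\<close>, outside like \<open>U\<close> and \<open>U'\<close>.\<close>
  have "inf X Y = sup (inf U U') (inf (inf (sup U V) (sup U' V')) B)"
    unfolding X Y by (auto simp: fun_eq_iff)
  moreover have "inf U U' \<in> T" "inf (sup U V) (sup U' V') \<in> T"
    using T by (simp_all add: soft_topology_inf[OF top] soft_topology_sup[OF top])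
  ultimately show "inf X Y \<in> simple_extension T B"
    unfolding simple_extension_def by blast
next
  fix \<W> assume "\<W> \<subseteq> simple_extension T B"
  then obtain u v where uv: "\<And>W. W \<in> \<W> \<Longrightarrow> u W \<in> T" "\<And>W. W \<in> \<W> \<Longrightarrow> v W \<in> T"
    and W: "\<And>W. W \<in> \<W> \<Longrightarrow> W = sup (u W) (inf (v W) B)"
    using simple_extension_choice[of \<W> T B] by metis
  have "(SUP W\<in>\<W>. W) = (SUP W\<in>\<W>. sup (u W) (inf (v W) B))"
    using W by (intro SUP_cong refl)
  then have "Sup \<W> = (SUP W\<in>\<W>. sup (u W) (inf (v W) B))"
    by simp
  also have "\<dots> = sup (SUP W\<in>\<W>. u W) (inf (SUP W\<in>\<W>. v W) B)"
    by (auto simp: fun_eq_iff)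
  moreover have "(SUP W\<in>\<W>. u W) \<in> T" "(SUP W\<in>\<W>. v W) \<in> T"
    using uv by (auto intro!: soft_topology_Sup[OF top])
  ultimately show "Sup \<W> \<in> simple_extension T B"
    unfolding simple_extension_def by auto
qed

text \<open>
  A member \<open>U \<union> (V \<inter> B)\<close> of a cover meets \<open>A\<close> only in \<open>U\<close>, so compactness of \<open>A\<close> selects finitely
  many members whose parts \<open>U\<close> cover \<open>A\<close>. What these parts leave over is closed, hence compact,
  for \<open>T\<close> and lies inside \<open>B\<close>, where \<open>U \<union> (V \<inter> B)\<close> agrees with the \<open>T\<close>-open set \<open>U \<union> V\<close>; so finitely
  many further members cover it.
\<close>

lemma soft_compact_space_simple_extension:
  assumes comp: "soft_compact_space Z E T" and A: "A \<in> soft_compact_sets Z E T"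
  shows "soft_compact_space Z E (simple_extension T (soft_complement Z E A))"
proof -
  let ?B = "soft_complement Z E A"
  have top: "soft_topology Z E T"
    using comp by (simp add: soft_compact_space_def)
  have "\<exists>\<V>. \<V> \<subseteq> \<W> \<and> finite \<V> \<and> soft_absolute Z E \<le> Sup \<V>"
    if \<W>: "\<W> \<subseteq> simple_extension T ?B" and cov: "soft_absolute Z E \<le> Sup \<W>" for \<W>
  proof -
    obtain u v where u: "\<And>W. W \<in> \<W> \<Longrightarrow> u W \<in> T" and v: "\<And>W. W \<in> \<W> \<Longrightarrow> v W \<in> T"
      and W: "\<And>W. W \<in> \<W> \<Longrightarrow> W = sup (u W) (inf (v W) ?B)"
      using simple_extension_choice[OF \<W>] by metis
    have W_at: "W e = u W e \<union> (v W e \<inter> ?B e)" if "W \<in> \<W>" for W e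
      using fun_cong[OF W[OF that], of e] by simp
    have cov_at: "\<exists>W\<in>\<W>. z \<in> u W e \<union> (v W e \<inter> ?B e)" if "e \<in> E" "z \<in> Z" for e z
    proof -
      have "z \<in> (Sup \<W>) e"
        using le_funD[OF cov, of e] that by (auto simp: soft_absolute_def)
      then show ?thesis using W_at by auto
    qed
    have AS: "A \<in> soft_sets Z E"
      using A by (rule soft_compact_sets_in_soft_sets)
    have A_cov: "A \<le> (SUP W\<in>\<W>. u W)"
    proof (intro le_funI subsetI)
      fix e z assume z: "z \<in> A e"
      then have "e \<in> E" "z \<in> Z"
        using soft_sets_subset[OF AS] soft_sets_outside[OF AS] by blast+
      moreover have "z \<notin> ?B e"
        using z by (simp add: soft_complement_def)
      ultimately show "z \<in> (SUP W\<in>\<W>. u W) e"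
        using cov_at[of e z] by auto
    qed
    obtain J where J: "J \<subseteq> \<W>" "finite J" "A \<le> (SUP W\<in>J. u W)"
      by (rule soft_compact_sets_finite_subcover[where I = \<W> and G = u, OF A u A_cov]) blast+
    let ?C = "soft_complement Z E (SUP W\<in>J. u W)"
    have "(SUP W\<in>J. u W) \<in> T"
      using J(1) u by (auto intro!: soft_topology_Sup[OF top])
    then have C: "?C \<in> soft_compact_sets Z E T"
      using soft_closed_subset_compact[OF comp] by (auto simp: soft_closed_sets_def)
    have uv: "sup (u W) (v W) \<in> T" if "W \<in> \<W>" for W
      using that u v by (simp add: soft_topology_sup[OF top])
    have C_cov: "?C \<le> (SUP W\<in>\<W>. sup (u W) (v W))"
    proof (intro le_funI subsetI)
      fix e z assume "z \<in> ?C e"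
      then have "e \<in> E" "z \<in> Z"
        by (auto simp: soft_complement_def split: if_splits)
      then show "z \<in> (SUP W\<in>\<W>. sup (u W) (v W)) e"
        using cov_at[of e z] by auto
    qed
    obtain K where K: "K \<subseteq> \<W>" "finite K" "?C \<le> (SUP W\<in>K. sup (u W) (v W))"
      by (rule soft_compact_sets_finite_subcover
          [where I = \<W> and G = "\<lambda>W. sup (u W) (v W)", OF C uv C_cov]) blast+
    have "soft_absolute Z E \<le> Sup (J \<union> K)"
    proof (intro le_funI subsetI)
      fix e z assume "z \<in> soft_absolute Z E e"
      then have ez: "e \<in> E" "z \<in> Z"
        by (auto simp: soft_absolute_def split: if_splits)
      show "z \<in> Sup (J \<union> K) e"
      proof (cases "\<exists>W\<in>J. z \<in> u W e")
        case True
        then obtain W where "W \<in> J" "z \<in> u W e" by blast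
        then have "z \<in> W e"
          using J(1) W_at[of W e] by auto
        with \<open>W \<in> J\<close> show ?thesis by auto
      next
        case False
        then have "z \<in> ?C e" "z \<in> ?B e"
          using ez J(3) by (auto simp: soft_complement_def le_fun_def)
        moreover obtain W where "W \<in> K" "z \<in> u W e \<union> v W e"
          using le_funD[OF K(3), of e] \<open>z \<in> ?C e\<close> by auto
        ultimately have "z \<in> W e"
          using K(1) W_at[of W e] by auto
        with \<open>W \<in> K\<close> show ?thesis by auto
      qed
    qed
    then show ?thesis
      using J(1,2) K(1,2) by (intro exI[of _ "J \<union> K"]) auto
  qed
  moreover have "soft_topology Z E (simple_extension T ?B)"
    using top soft_complement_in_soft_sets by (rule soft_topology_simple_extension)
  moreover have "soft_absolute Z E \<in> soft_sets Z E"
    by (auto simp: soft_absolute_def soft_sets_def)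
  ultimately show ?thesis
    by (simp add: soft_compact_space_def soft_compact_sets_def)
qed

section \<open>Maximality and coincidence of closed with compact sets\<close>

lemma maximal_imp_closed_eq_compact:
  assumes "maximal_soft_compact Z E T"
  shows "soft_closed_sets Z E T = soft_compact_sets Z E T"
proof
  have comp: "soft_compact_space Z E T" and top: "soft_topology Z E T"
    using assms by (auto simp: maximal_soft_compact_def soft_compact_space_def)
  show "soft_closed_sets Z E T \<subseteq> soft_compact_sets Z E T"
    using comp by (rule soft_closed_subset_compact)
  show "soft_compact_sets Z E T \<subseteq> soft_closed_sets Z E T"
  proof
    fix A assume A: "A \<in> soft_compact_sets Z E T"
    let ?B = "soft_complement Z E A"
    have "soft_compact_space Z E (simple_extension T ?B)"
      using comp A by (rule soft_compact_space_simple_extension)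
    then have "\<not> T \<subset> simple_extension T ?B"
      using assms by (auto simp: maximal_soft_compact_def soft_compact_space_def)
    then have "?B \<in> T"
      using subset_simple_extension[OF top, of ?B]
        in_simple_extension[OF top soft_complement_in_soft_sets, of A] by blast
    then show "A \<in> soft_closed_sets Z E T"
      using soft_closed_sets_iff[OF top] soft_compact_sets_in_soft_sets[OF A] by blast
  qed
qed

text \<open>Complements of sets open in a finer compact topology \<open>T'\<close> are compact for \<open>T'\<close>, hence for the
  coarser \<open>T\<close>, hence closed for \<open>T\<close>.\<close>

lemma closed_eq_compact_imp_maximal:
  assumes top: "soft_topology Z E T" and eq: "soft_closed_sets Z E T = soft_compact_sets Z E T"
  shows "maximal_soft_compact Z E T"
proof -
  have "soft_absolute Z E \<in> soft_closed_sets Z E T"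
    using soft_topology_null[OF top] soft_complement_null
    unfolding soft_closed_sets_def by (metis image_eqI)
  then have "soft_compact_space Z E T"
    using top eq by (simp add: soft_compact_space_def)
  moreover have "T' \<subseteq> T" if sub: "T \<subseteq> T'" and comp: "soft_compact_space Z E T'" for T'
  proof
    fix W assume W: "W \<in> T'"
    have "W \<in> soft_sets Z E"
      using comp W soft_topology_subset by (auto simp: soft_compact_space_def)
    have "soft_complement Z E W \<in> soft_compact_sets Z E T'"
      using soft_closed_subset_compact[OF comp] W by (auto simp: soft_closed_sets_def)
    then have "soft_complement Z E W \<in> soft_closed_sets Z E T"
      using soft_compact_sets_antimono[OF sub] eq by auto
    then show "W \<in> T"
      using soft_closed_sets_iff[OF top] soft_complement_complement[OF \<open>W \<in> soft_sets Z E\<close>]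
      by metis
  qed
  ultimately show ?thesis
    by (auto simp: maximal_soft_compact_def)
qed

section \<open>Continuous bijections from compact spaces\<close>

lemma soft_compact_sets_image:
  assumes cont: "soft_continuous Y E' T' Z E T p q" and A: "A \<in> soft_compact_sets Y E' T'"
  shows "soft_image E' p q A \<in> soft_compact_sets Z E T"
proof -
  have pq: "p \<in> Y \<rightarrow> Z" "q \<in> E' \<rightarrow> E"
    and vim: "\<And>B. B \<in> T \<Longrightarrow> soft_vimage Y E' p q B \<in> T'"
    using cont by (auto simp: soft_continuous_def soft_function_def)
  have AS: "A \<in> soft_sets Y E'"
    using A by (rule soft_compact_sets_in_soft_sets)
  have "soft_image E' p q A \<in> soft_sets Z E"
    using pq soft_sets_subset[OF AS] by (fastforce simp: soft_sets_def soft_image_def)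
  moreover have "\<exists>\<V>. \<V> \<subseteq> \<U> \<and> finite \<V> \<and> soft_image E' p q A \<le> Sup \<V>"
    if \<U>: "\<U> \<subseteq> T" and cov: "soft_image E' p q A \<le> Sup \<U>" for \<U>
  proof -
    have "A \<le> (SUP B\<in>\<U>. soft_vimage Y E' p q B)"
    proof (intro le_funI subsetI)
      fix e y assume y: "y \<in> A e"
      then have ey: "e \<in> E'" "y \<in> Y"
        using soft_sets_subset[OF AS] soft_sets_outside[OF AS] by blast+
      then have "p y \<in> soft_image E' p q A (q e)"
        using y by (auto simp: soft_image_def)
      then have "p y \<in> Sup \<U> (q e)"
        using cov by (auto simp: le_fun_def)
      then show "y \<in> (SUP B\<in>\<U>. soft_vimage Y E' p q B) e"
        using ey by (auto simp: soft_vimage_def)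
    qed
    then obtain \<V> where \<V>: "\<V> \<subseteq> \<U>" "finite \<V>" "A \<le> (SUP B\<in>\<V>. soft_vimage Y E' p q B)"
      using soft_compact_sets_finite_subcover[OF A, of \<U> "soft_vimage Y E' p q"] vim \<U> by blast
    have "soft_image E' p q A \<le> Sup \<V>"
    proof (intro le_funI subsetI)
      fix e z assume "z \<in> soft_image E' p q A e"
      then obtain e' y where e': "e' \<in> E'" "q e' = e" "y \<in> A e'" "z = p y"
        by (auto simp: soft_image_def)
      then have "y \<in> (SUP B\<in>\<V>. soft_vimage Y E' p q B) e'"
        using \<V>(3) by (auto simp: le_fun_def)
      then show "z \<in> Sup \<V> e"
        using e' by (auto simp: soft_vimage_def)
    qed
    with \<V>(1,2) show ?thesis by blast
  qed
  ultimately show ?thesis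
    by (simp add: soft_compact_sets_def)
qed

lemma soft_image_complement:
  assumes bij: "soft_bijective Y E' Z E p q" and W: "W \<in> soft_sets Y E'"
  shows "soft_image E' p q (soft_complement Y E' W) = soft_complement Z E (soft_image E' p q W)"
proof
  fix e
  have p: "inj_on p Y" "p ` Y = Z" and q: "inj_on q E'" "q ` E' = E"
    using bij by (auto simp: soft_bijective_def bij_betw_def)
  show "soft_image E' p q (soft_complement Y E' W) e
      = soft_complement Z E (soft_image E' p q W) e"
  proof (cases "e \<in> E")
    case False
    then show ?thesis using q(2) by (auto simp: soft_image_def soft_complement_def)
  next
    case True
    then obtain e' where e': "e' \<in> E'" "q e' = e" using q(2) by auto
    then have fibre: "{x \<in> E'. q x = e} = {e'}"
      using q(1) by (auto dest: inj_onD)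
    have "p ` (Y - W e') = Z - p ` W e'"
      using inj_on_image_set_diff[OF p(1) Diff_subset soft_sets_subset[OF W]] p(2) by auto
    then show ?thesis
      using True e' by (simp add: soft_image_def soft_complement_def fibre)
  qed
qed

lemma closed_eq_compact_imp_homeomorphism:
  assumes top: "soft_topology Z E T" and eq: "soft_closed_sets Z E T = soft_compact_sets Z E T"
    and comp: "soft_compact_space Y E' T'" and cont: "soft_continuous Y E' T' Z E T p q"
    and bij: "soft_bijective Y E' Z E p q"
  shows "soft_homeomorphism Y E' T' Z E T p q"
proof -
  have fn: "p \<in> Y \<rightarrow> Z" "q \<in> E' \<rightarrow> E"
    using cont by (auto simp: soft_continuous_def soft_function_def)
  have "soft_image E' p q W \<in> T" if W: "W \<in> T'" for W
  proof -
    have WS: "W \<in> soft_sets Y E'"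
      using comp W soft_topology_subset by (auto simp: soft_compact_space_def)
    have imS: "soft_image E' p q W \<in> soft_sets Z E"
      using fn soft_sets_subset[OF WS] by (fastforce simp: soft_sets_def soft_image_def)
    have "soft_complement Y E' W \<in> soft_compact_sets Y E' T'"
      using soft_closed_subset_compact[OF comp] W by (auto simp: soft_closed_sets_def)
    then have "soft_complement Z E (soft_image E' p q W) \<in> soft_closed_sets Z E T"
      using soft_compact_sets_image[OF cont] soft_image_complement[OF bij WS] eq by metis
    then show ?thesis
      using soft_closed_sets_iff[OF top] soft_complement_complement[OF imS] by metis
  qed
  then show ?thesis
    using cont bij fn by (simp add: soft_homeomorphism_def soft_open_function_def soft_function_def)
qed

text \<open>It suffices to test the identity maps, from the same carriers with a finer compact
  topology: each is a continuous bijection, and its openness says that the two topologies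
  agree.\<close>

lemma bijections_homeomorphisms_imp_maximal:
  fixes Z :: "'z set" and E :: "'e set"
  assumes comp: "soft_compact_space Z E T"
    and homeo: "\<And>(Y :: 'z set) (E' :: 'e set) T' p q.
      soft_compact_space Y E' T' \<Longrightarrow> soft_continuous Y E' T' Z E T p q \<Longrightarrow>
      soft_bijective Y E' Z E p q \<Longrightarrow> soft_homeomorphism Y E' T' Z E T p q"
  shows "maximal_soft_compact Z E T"
proof -
  have "T' \<subseteq> T" if sub: "T \<subseteq> T'" and comp': "soft_compact_space Z E T'" for T'
  proof
    fix W assume W: "W \<in> T'"
    have T'S: "T' \<subseteq> soft_sets Z E"
      using comp' soft_topology_subset by (auto simp: soft_compact_space_def)
    have vim: "soft_vimage Z E id id B = B" if "B \<in> soft_sets Z E" for B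
      using that by (auto simp: soft_vimage_def soft_sets_def fun_eq_iff)
    have im: "soft_image E id id B = B" if "B \<in> soft_sets Z E" for B
      using that by (auto simp: soft_image_def soft_sets_def fun_eq_iff)
    have "soft_continuous Z E T' Z E T id id"
      using sub T'S vim by (force simp: soft_continuous_def soft_function_def)
    moreover have "soft_bijective Z E Z E id id"
      by (simp add: soft_bijective_def)
    ultimately have "soft_homeomorphism Z E T' Z E T id id"
      by (rule homeo[OF comp'])
    then have "soft_image E id id W \<in> T"
      using W by (simp add: soft_homeomorphism_def soft_open_function_def)
    then show "W \<in> T"
      using im W T'S by auto
  qed
  then show ?thesis
    using comp by (auto simp: maximal_soft_compact_def)
qed

theorem theorem3p16:
  fixes Z :: "'z set" and E :: "'e set" and T :: "('e \<Rightarrow> 'z set) set"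
  assumes "soft_topology Z E T"
  shows
    "(maximal_soft_compact Z E T \<longleftrightarrow> soft_closed_sets Z E T = soft_compact_sets Z E T) \<and>
     (maximal_soft_compact Z E T \<longrightarrow>
        (\<forall>(Y :: 'y set) (E' :: 'f set) T' p q.
           soft_compact_space Y E' T' \<and>
           soft_continuous Y E' T' Z E T p q \<and> soft_bijective Y E' Z E p q \<longrightarrow>
           soft_homeomorphism Y E' T' Z E T p q)) \<and>
     (soft_compact_space Z E T \<longrightarrow>
        (maximal_soft_compact Z E T \<longleftrightarrow>
          (\<forall>(Y :: 'z set) (E' :: 'e set) T' p q.
             soft_compact_space Y E' T' \<and>
             soft_continuous Y E' T' Z E T p q \<and> soft_bijective Y E' Z E p q \<longrightarrow>
             soft_homeomorphism Y E' T' Z E T p q)))"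
proof -
  have closed_compact:
    "maximal_soft_compact Z E T \<longleftrightarrow> soft_closed_sets Z E T = soft_compact_sets Z E T"
    using maximal_imp_closed_eq_compact closed_eq_compact_imp_maximal[OF assms] by blast
  show ?thesis
    by (intro conjI impI iffI allI closed_compact bijections_homeomorphisms_imp_maximal)
      (auto intro: closed_eq_compact_imp_homeomorphism[OF assms] simp: closed_compact)
qed

end
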